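(* Let $k$ be an algebraically closed field of characteristic zero. Let $f\in k[[X,Y]]$ be an irreducible power series of order $n\ge 2$ which is not quasi-homogeneous, and let $R:=\frac{k[[X,Y]]}{(f)}$. Suppose $R$ has a parametric representation $$x=t^n,\qquad y=t^m+bt^\lambda+\text{(terms of degree higher than }\lambda),$$ where $m>n$ is an integer which is not a multiple of $n$, $b\in k$ is nonzero, $\lambda>m$, and $\lambda+n\notin v(R)$. If $\gcd(m,n)$ does not divide $\lambda$, then $\lambda+2n\notin v(R)$.
   Context: The order of a nonzero $f\in k[[X,Y]]$ is the largest non-negative integer $i$ with $f\in\mathfrak M^i$, where $\mathfrak M=(X,Y)$. A pair of variables of $k[[X,Y]]$ is a pair $U,V\in\mathfrak M$ with $k[[U,V]]=k[[X,Y]]$. An irreducible power series $f\in k[[X,Y]]$ of order $>1$ is called quasi-homogeneous if there exists a pair of variables $U,V$ of $k[[X,Y]]$ such that $(f)=(V^p-U^q)$ for some positive integers $p,q\ge 2$ (necessarily relatively prime); equivalently, $k[[X,Y]]/(f)\cong k[[t^p,t^q]]$ as $k$-algebras for some relatively prime integers $p,q\ge 2$. The integral closure $\overline R$ of $R$ in its field of fractions is a complete discrete valuation ring isomorphic to $k[[t]]$, with valuation $v=\mathrm{ord}_t$; $R$ is regarded as a subring of $k[[t]]$. A parametric representation $x=x(t)$, $y=y(t)$ of $R$ means that, for a suitable choice of pair of variables of $k[[X,Y]]$ with residue classes $x,y$ in $R$ and of uniformizing parameter $t$ of $\overline R$, one has $R=k[[x(t),y(t)]]\subseteq k[[t]]=\overline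 R$. The value semi-group of $R$ is $v(R):=\{v(r) : r\in R\setminus\{0\}\}\subseteq\mathbb N$, where $\mathbb N$ denotes the non-negative integers. *)

theory Defs
  imports
    "HOL-Algebra.Algebraic_Closure_Type"
    "HOL-Algebra.Ideal_Product"
    "HOL-Algebra.QuotRing"
begin

section \<open>The power series ring in two variables\<close>

text \<open>
  \<open>k[[X,Y]]\<close> is represented by \<^typ>\<open>'k fps fps\<close>, read as \<open>k[[X]][[Y]]\<close>:
  the coefficient of \<open>X\<^sup>i Y\<^sup>j\<close> in \<open>G\<close> is \<open>fps_nth (fps_nth G j) i\<close>.
\<close>

definition bcoeff :: "'k::field fps fps \<Rightarrow> nat \<Rightarrow> nat \<Rightarrow> 'k" where
  "bcoeff G i j = fps_nth (fps_nth G j) i"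

definition varX :: "'k::field fps fps" where
  "varX = fps_const fps_X"

definition varY :: "'k::field fps fps" where
  "varY = fps_X"

abbreviation kXY :: "'k::field fps fps ring" where
  "kXY \<equiv> ring_of_type_algebra"

definition max_ideal :: "'k::field fps fps set" where
  "max_ideal = Idl\<^bsub>kXY\<^esub> {varX, varY}"

definition ord2 :: "'k::field fps fps \<Rightarrow> nat" where
  "ord2 f = (GREATEST i. f \<in> max_ideal [^]\<^bsub>ideals_set kXY\<^esub> i)"

text \<open>
  Substitution \<open>G(U,V)\<close>. For \<open>U, V\<close> in the maximal ideal, \<open>U\<^sup>i V\<^sup>j\<close> has no monomial of total
  degree below \<open>i + j\<close>, so the finite sums below are exactly the coefficients of the
  (adically convergent) infinite sum. For other \<open>U, V\<close> the value is meaningless and never used.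
  The same remark applies to \<open>subst1\<close>, where \<open>x, y\<close> are series in \<open>t\<close> without constant term.
\<close>

definition subst2 :: "'k::field fps fps \<Rightarrow> 'k fps fps \<Rightarrow> 'k fps fps \<Rightarrow> 'k fps fps" where
  "subst2 G U V = Abs_fps (\<lambda>b. Abs_fps (\<lambda>a.
     \<Sum>i\<le>a + b. \<Sum>j\<le>a + b. bcoeff G i j * bcoeff (U ^ i * V ^ j) a b))"

definition subst1 :: "'k::field fps fps \<Rightarrow> 'k fps \<Rightarrow> 'k fps \<Rightarrow> 'k fps" where
  "subst1 G x y = Abs_fps (\<lambda>d.
     \<Sum>i\<le>d. \<Sum>j\<le>d. bcoeff G i j * fps_nth (x ^ i * y ^ j) d)"

definition pair_of_variables :: "'k::field fps fps \<Rightarrow> 'k fps fps \<Rightarrow> bool" where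
  "pair_of_variables U V \<longleftrightarrow>
     U \<in> max_ideal \<and> V \<in> max_ideal \<and> range (\<lambda>G. subst2 G U V) = UNIV"

definition quasi_homogeneous :: "'k::field fps fps \<Rightarrow> bool" where
  "quasi_homogeneous f \<longleftrightarrow>
     Factorial_Ring.irreducible f \<and> ord2 f > 1 \<and>
     (\<exists>U V p q. pair_of_variables U V \<and> p \<ge> 2 \<and> q \<ge> 2 \<and>
        Idl\<^bsub>kXY\<^esub> {f} = Idl\<^bsub>kXY\<^esub> {V ^ p - U ^ q})"

section \<open>The plane branch and its normalization\<close>

definition branch_ring :: "'k::field fps fps \<Rightarrow> 'k fps fps set ring" where
  "branch_ring f = kXY Quot (Idl\<^bsub>kXY\<^esub> {f})"

definition residue_class :: "'k::field fps fps \<Rightarrow> 'k fps fps \<Rightarrow> 'k fps fps set" where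
  "residue_class f g = Idl\<^bsub>kXY\<^esub> {f} +>\<^bsub>kXY\<^esub> g"

definition fractions_of :: "'b::field set \<Rightarrow> 'b set" where
  "fractions_of S = {a / b | a b. a \<in> S \<and> b \<in> S \<and> b \<noteq> 0}"

definition integral_closure :: "'b::field set \<Rightarrow> 'b set \<Rightarrow> 'b set" where
  "integral_closure S L = {z \<in> L. \<exists>p. lead_coeff p = 1 \<and> (\<forall>i. coeff p i \<in> S) \<and> poly p z = 0}"

text \<open>
  \<open>\<iota>\<close> embeds \<open>R = k[[X,Y]]/(f)\<close> as a \<open>k\<close>-algebra into \<open>k[[t]]\<close>, in such a way that
  \<open>k[[t]]\<close> is the integral closure of the image in its field of fractions, formed inside
  \<open>k((t))\<close>. Choosing \<open>\<iota>\<close> comprises choosing the uniformizing parameter \<open>t\<close>.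
\<close>

definition normalization :: "'k::field fps fps \<Rightarrow> ('k fps fps set \<Rightarrow> 'k fps) \<Rightarrow> bool" where
  "normalization f \<iota> \<longleftrightarrow>
     \<iota> \<in> ring_hom (branch_ring f) ring_of_type_algebra \<and>
     (\<forall>c. \<iota> (residue_class f (fps_const (fps_const c))) = fps_const c) \<and>
     inj_on \<iota> (carrier (branch_ring f)) \<and>
     (let S = fps_to_fls ` \<iota> ` carrier (branch_ring f)
      in integral_closure S (fractions_of S) = range fps_to_fls)"

definition parametric_representation ::
    "'k::field fps fps \<Rightarrow> ('k fps fps set \<Rightarrow> 'k fps) \<Rightarrow> 'k fps \<Rightarrow> 'k fps \<Rightarrow> bool" where
  "parametric_representation f \<iota> x y \<longleftrightarrow>
     normalization f \<iota> \<and>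
     (\<exists>U V. pair_of_variables U V \<and>
        \<iota> (residue_class f U) = x \<and> \<iota> (residue_class f V) = y) \<and>
     \<iota> ` carrier (branch_ring f) = range (\<lambda>G. subst1 G x y)"

definition value_semigroup ::
    "'k::field fps fps \<Rightarrow> ('k fps fps set \<Rightarrow> 'k fps) \<Rightarrow> nat set" where
  "value_semigroup f \<iota> =
     {subdegree (\<iota> r) | r. r \<in> carrier (branch_ring f) - {\<zero>\<^bsub>branch_ring f\<^esub>}}"

end

theory Submission
  imports Defs
begin

text \<open>
  Put \<open>d = gcd m n\<close>, \<open>n' = n / d\<close>, \<open>m' = m / d\<close> and \<open>N = \<lambda> + 2n\<close>. Since \<open>d\<close> does not divide
  \<open>\<lambda>\<close>, the exponent \<open>\<lambda>\<close> is the second characteristic exponent of the branch, and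
  \<open>z = y\<^bsup>n'\<^esup> - x\<^bsup>m'\<^esup>\<close> has the corresponding value \<open>B = \<lambda> + (n' - 1) m\<close>
  (\<open>subdegree_power_diff\<close>). Since \<open>n\<close> does not divide \<open>m\<close>, \<open>n' \<ge> 2\<close>;
  then \<open>(n' - 1) m \<ge> m > n\<close> gives \<open>B + n > N\<close>, and hence
  \<open>B + m > N\<close>; so \<open>x z\<close> and \<open>y z\<close> vanish modulo \<open>t\<^bsup>N+1\<^esup>\<close>.

  Replacing \<open>y\<^bsup>n'\<^esup>\<close> by \<open>x\<^bsup>m'\<^esup> + z\<close> repeatedly therefore shows that modulo \<open>t\<^bsup>N+1\<^esup>\<close> the ring
  \<open>R\<close> is spanned over \<open>k\<close> by the single element \<open>z\<close> and the \<open>x\<^bsup>i\<^esup> y\<^bsup>j\<^esup>\<close> with \<open>j < n'\<close>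
  (\<open>monomial_in_span\<close>). The values of these elements are pairwise distinct: the values
  \<open>n i + m j\<close> of the monomials are multiples of \<open>d\<close> and differ from each other because
  \<open>m'\<close> is invertible modulo \<open>n'\<close> (\<open>exponents_inj\<close>), while \<open>B\<close> is not a multiple of \<open>d\<close>. In a linear combination of elements of distinct values no cancellation of leading terms
  is possible (\<open>subdegree_span\<close>), so every value up to \<open>N\<close> in \<open>v(R)\<close> is either a multiple of
  \<open>d\<close> or equal to \<open>B\<close>. The number \<open>N\<close> is neither: \<open>N = B\<close> would mean
  \<open>(n' - 1) m' = 2 n'\<close>, which is impossible because \<open>n' > 1\<close> is coprime to both \<open>n' - 1\<close> and \<open>m'\<close>.
\<close>

section \<open>Orders of linear combinations of power series\<close>

interpretation fps_vs: vector_space "\<lambda>(c::'k::field) (g::'k fps). fps_const c * g"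
  by unfold_locales (simp_all add: algebra_simps flip: fps_const_add fps_const_mult)

text \<open>
  Among the elements that occur with nonzero coefficient, exactly one has the least order, so its
  leading term survives.
\<close>
lemma subdegree_span:
  fixes E :: "'k::field fps set"
  assumes "g \<in> fps_vs.span E" "g \<noteq> 0" "0 \<notin> E" "inj_on subdegree E"
  shows "subdegree g \<in> subdegree ` E"
proof -
  obtain T r where T: "finite T" "T \<subseteq> E" and g: "g = (\<Sum>a\<in>T. fps_const (r a) * a)"
    using assms(1) unfolding fps_vs.span_explicit by blast
  define T' where "T' = {a \<in> T. r a \<noteq> 0}"
  have T': "finite T'" "T' \<subseteq> E"
    using T by (auto simp: T'_def)
  have g': "g = (\<Sum>a\<in>T'. fps_const (r a) * a)"
    unfolding g T'_def using T(1) by (intro sum.mono_neutral_right) auto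
  have "T' \<noteq> {}"
    using assms(2) g' by auto
  then obtain e where e: "e \<in> T'" "\<And>a. a \<in> T' \<Longrightarrow> subdegree e \<le> subdegree a"
    using T'(1) that[of "arg_min_on subdegree T'"]
    by (simp add: arg_min_if_finite(1) arg_min_least)
  have other: "fps_nth a (subdegree e) = 0" if "a \<in> T'" "a \<noteq> e" for a
  proof -
    have "subdegree a \<noteq> subdegree e"
      using that e(1) T'(2) assms(4) by (meson inj_onD subsetD)
    with e(2)[OF that(1)] show ?thesis
      by (intro nth_less_subdegree_zero) linarith
  qed
  have "fps_nth g (subdegree e) = (\<Sum>a\<in>T'. r a * fps_nth a (subdegree e))"
    by (simp add: g' fps_sum_nth)
  also have "\<dots> = (\<Sum>a\<in>{e}. r a * fps_nth a (subdegree e))"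
    using T'(1) e(1) other by (intro sum.mono_neutral_right) auto
  finally have lead: "fps_nth g (subdegree e) \<noteq> 0"
    using e(1) T'(2) assms(3) by (auto simp: T'_def)
  have "fps_nth g i = 0" if "i < subdegree e" for i
    unfolding g' fps_sum_nth
    using that e(2) by (intro sum.neutral) (force intro: nth_less_subdegree_zero)
  with lead have "subdegree g = subdegree e"
    by (intro subdegreeI) auto
  thus ?thesis
    using e(1) T'(2) by auto
qed

text \<open>
  As \<open>x\<close> and \<open>y\<close> have no constant term, \<open>x\<^bsup>i\<^esup> y\<^bsup>j\<^esup>\<close> cannot contribute to a coefficient of index below
  \<open>i\<close> or below \<open>j\<close>.
\<close>
lemma subst1_truncate:
  fixes x y :: "'k::field fps"
  assumes "fps_nth x 0 = 0" "fps_nth y 0 = 0"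
  shows "\<exists>q. subst1 G x y =
    (\<Sum>i\<le>N. \<Sum>j\<le>N. fps_const (bcoeff G i j) * (x ^ i * y ^ j)) + fps_X ^ Suc N * q"
proof -
  let ?P = "\<Sum>i\<le>N. \<Sum>j\<le>N. fps_const (bcoeff G i j) * (x ^ i * y ^ j)"
  have vanish: "fps_nth (x ^ i * y ^ j) e = 0" if "e < i \<or> e < j" for i j e
  proof (cases "x ^ i * y ^ j = 0")
    case False
    hence "subdegree (x ^ i * y ^ j) = i * subdegree x + j * subdegree y"
      by (subst subdegree_mult) (auto simp: subdegree_power)
    moreover have "i = 0 \<or> subdegree x \<ge> 1" "j = 0 \<or> subdegree y \<ge> 1"
      using False assms by (auto simp: Suc_le_eq intro: ccontr simp: subdegree_eq_0_iff)
    ultimately have "subdegree (x ^ i * y ^ j) \<ge> i" "subdegree (x ^ i * y ^ j) \<ge> j"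
      by (auto simp: trans_le_add1 trans_le_add2)
    thus ?thesis
      using that by (intro nth_less_subdegree_zero) linarith
  next
    case True
    thus ?thesis by (simp only: fps_zero_nth)
  qed
  have eq: "fps_nth (subst1 G x y) e = fps_nth ?P e" if "e \<le> N" for e
  proof -
    have "fps_nth ?P e = (\<Sum>i\<le>N. \<Sum>j\<le>N. bcoeff G i j * fps_nth (x ^ i * y ^ j) e)"
      by (simp add: fps_sum_nth)
    also have "\<dots> = (\<Sum>i\<le>e. \<Sum>j\<le>N. bcoeff G i j * fps_nth (x ^ i * y ^ j) e)"
      using that by (intro sum.mono_neutral_right) (auto simp: vanish intro!: sum.neutral)
    also have "\<dots> = (\<Sum>i\<le>e. \<Sum>j\<le>e. bcoeff G i j * fps_nth (x ^ i * y ^ j) e)"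
      using that by (intro sum.cong[OF refl] sum.mono_neutral_right) (auto simp: vanish)
    finally show ?thesis
      by (simp add: subst1_def)
  qed
  define q where "q = fps_shift (Suc N) (subst1 G x y - ?P)"
  have "subst1 G x y - ?P = fps_X ^ Suc N * q"
  proof (rule fps_ext)
    fix e
    show "fps_nth (subst1 G x y - ?P) e = fps_nth (fps_X ^ Suc N * q) e"
      using eq[of e] unfolding fps_X_power_mult_nth q_def
      by (cases "e < Suc N") (simp_all del: power_Suc)
  qed
  hence "subst1 G x y = ?P + fps_X ^ Suc N * q"
    by (simp add: algebra_simps)
  thus ?thesis ..
qed

section \<open>The element of second characteristic value\<close>

text \<open>
  Write \<open>y = t\<^bsup>m\<^esup> u\<close> with \<open>u(0) = 1\<close>. In \<open>u\<^bsup>p\<^esup> - 1 = (u - 1) (1 + u + \<dots> + u\<^bsup>p-1\<^esup>)\<close> the second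
  factor has constant term \<open>p\<close>, so in characteristic zero it is a unit and the order is that of
  \<open>u - 1\<close>.
\<close>
lemma subdegree_power_diff:
  fixes y :: "'k::field_char_0 fps"
  assumes "y - fps_X ^ m \<noteq> 0" "subdegree (y - fps_X ^ m) > m" "p > 0"
  shows "y ^ p - fps_X ^ (m * p) \<noteq> 0"
    and "subdegree (y ^ p - fps_X ^ (m * p)) = subdegree (y - fps_X ^ m) + (p - 1) * m"
proof -
  define u where "u = fps_shift m y"
  have low: "fps_nth y i = fps_nth (fps_X ^ m :: 'k fps) i" if "i \<le> m" for i
    using nth_less_subdegree_zero[of i "y - fps_X ^ m"] that assms(2) by simp
  have y: "y = fps_X ^ m * u"
    using low by (intro fps_ext) (auto simp: fps_X_power_mult_nth u_def)
  have u0: "fps_nth u 0 = 1"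
    using low[of m] by (simp add: u_def)
  define c where "c = (\<Sum>i<p. u ^ i)"
  have c0: "fps_nth c 0 = of_nat p"
    by (simp add: c_def fps_sum_nth fps_nth_power_0 u0)
  hence "c \<noteq> 0" and sc: "subdegree c = 0"
    using assms(3) by auto
  have fac: "y - fps_X ^ m = fps_X ^ m * (u - 1)"
    by (simp add: y algebra_simps)
  have split: "(fps_X ^ (m * p) :: 'k fps) = fps_X ^ ((p - 1) * m) * fps_X ^ m"
    using assms(3) by (cases p) (simp_all add: power_add mult_ac)
  have "y ^ p - fps_X ^ (m * p) = fps_X ^ (m * p) * (u ^ p - 1)"
    by (simp add: y power_mult_distrib power_mult algebra_simps)
  also have "\<dots> = fps_X ^ (m * p) * ((u - 1) * c)"
    by (simp add: power_diff_1_eq c_def)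
  also have "\<dots> = fps_X ^ ((p - 1) * m) * fps_X ^ m * ((u - 1) * c)"
    by (simp only: split)
  also have "\<dots> = fps_X ^ ((p - 1) * m) * ((y - fps_X ^ m) * c)"
    by (simp only: fac mult_ac)
  finally have eq: "y ^ p - fps_X ^ (m * p) = fps_X ^ ((p - 1) * m) * ((y - fps_X ^ m) * c)" .
  show "y ^ p - fps_X ^ (m * p) \<noteq> 0"
    unfolding eq using assms(1) \<open>c \<noteq> 0\<close> by simp
  show "subdegree (y ^ p - fps_X ^ (m * p)) = subdegree (y - fps_X ^ m) + (p - 1) * m"
    unfolding eq using assms(1) \<open>c \<noteq> 0\<close> sc by (simp add: subdegree_mult)
qed

section \<open>A spanning set modulo a power of the parameter\<close>

text \<open>
  Rewriting \<open>y\<^bsup>p\<^esup>\<close> as \<open>x\<^bsup>q\<^esup> + z\<close> lowers the exponent of \<open>y\<close>. The error it creates is \<open>z\<close>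
  itself or a multiple of \<open>x z\<close> or \<open>y z\<close>; such multiples lie in the ideal \<open>J\<close> generated by \<open>w\<close>.
  In the application \<open>w\<close> is a power of \<open>t\<close>.
\<close>
lemma monomial_in_span:
  fixes x y w :: "'k::field fps"
  defines "J \<equiv> range (\<lambda>q. w * q)"
  assumes z: "z = y ^ p - x ^ q" and "p > 0"
    and xz: "x * z \<in> J" and yz: "y * z \<in> J"
  shows "x ^ i * y ^ j \<in> fps_vs.span (insert z {x ^ i * y ^ j | i j. j < p} \<union> J)"
    (is "_ \<in> fps_vs.span ?S")
proof (induction j arbitrary: i rule: less_induct)
  case (less j)
  have J_mult: "a * b \<in> J" if "b \<in> J" for a b
    using that unfolding J_def by (auto simp: mult.left_commute)
  show ?case
  proof (cases "j < p")
    case True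
    thus ?thesis by (intro fps_vs.span_base) auto
  next
    case False
    then obtain l where j: "j = p + l"
      using le_Suc_ex not_less by blast
    have "x ^ i * y ^ l * z \<in> ?S"
    proof (cases "i = 0 \<and> l = 0")
      case False
      then consider i' where "i = Suc i'" | l' where "l = Suc l'"
        by (metis not0_implies_Suc)
      hence "x ^ i * y ^ l * z \<in> J"
      proof cases
        case 1
        thus ?thesis using J_mult[OF xz, of "x ^ i' * y ^ l"] by (simp add: mult_ac)
      next
        case 2
        thus ?thesis using J_mult[OF yz, of "x ^ i * y ^ l'"] by (simp add: mult_ac)
      qed
      thus ?thesis by simp
    qed simp
    moreover have "x ^ (i + q) * y ^ l \<in> fps_vs.span ?S"
      using \<open>p > 0\<close> j by (intro less) simp
    moreover have "x ^ i * y ^ j = x ^ (i + q) * y ^ l + x ^ i * y ^ l * z"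
      by (simp add: z j power_add algebra_simps)
    ultimately show ?thesis
      by (simp add: fps_vs.span_add fps_vs.span_base)
  qed
qed

text \<open>
  After division by \<open>gcd m n\<close>, the equation modulo \<open>n'\<close> reads \<open>m' j = m' j'\<close>, where \<open>m'\<close> is
  invertible; since \<open>j\<close> and \<open>j'\<close> are below \<open>n'\<close>, this congruence is an equality.
\<close>
lemma exponents_inj:
  fixes m n :: nat
  assumes "n > 0" "j < n div gcd m n" "j' < n div gcd m n" "n * i + m * j = n * i' + m * j'"
  shows "i = i' \<and> j = j'"
proof -
  define d where "d = gcd m n"
  define n' where "n' = n div d"
  define m' where "m' = m div d"
  have d: "d > 0" "n = d * n'" "m = d * m'"
    using assms(1) by (auto simp: d_def n'_def m'_def)
  have cop: "coprime m' n'"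
    unfolding m'_def n'_def d_def using assms(1) by (intro div_gcd_coprime) auto
  have "d * (n' * i + m' * j) = d * (n' * i' + m' * j')"
    using assms(4) by (simp add: d(2,3) algebra_simps)
  hence eq: "n' * i + m' * j = n' * i' + m' * j'"
    using d(1) by simp
  have "int n' * (int i' - int i) = int m' * (int j - int j')"
    using arg_cong[OF eq, of int] by (simp add: algebra_simps)
  hence "int n' dvd int m' * (int j - int j')"
    by (metis dvd_triv_left)
  hence "int n' dvd int j - int j'"
    using cop by (simp add: coprime_commute coprime_dvd_mult_right_iff)
  moreover have "\<bar>int j - int j'\<bar> < int n'"
    using assms(2,3) unfolding n'_def d_def by linarith
  ultimately have "j = j'"
    using dvd_imp_le_int[of "int j - int j'" "int n'"] by fastforce
  thus ?thesis
    using eq assms(1) d(2) by auto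
qed

section \<open>The missing value\<close>

text \<open>
  The elements of \<open>R\<close> are exactly the series \<open>G(x, y)\<close>, so this is the claim about the value
  semigroup, freed from the quotient ring and its embedding.
\<close>
lemma subdegree_subst1_neq:
  fixes y :: "'k::field_char_0 fps"
  assumes sub: "y - fps_X ^ m \<noteq> 0" "subdegree (y - fps_X ^ m) = lam"
    and "n > 0" "m > n" "\<not> n dvd m" "lam > m" "\<not> gcd m n dvd lam"
  shows "subdegree (subst1 G (fps_X ^ n) y) \<noteq> lam + 2 * n"
proof
  define N where "N = lam + 2 * n"
  define d where "d = gcd m n"
  define n' where "n' = n div d"
  define m' where "m' = m div d"
  define x where "x = (fps_X ^ n :: 'k fps)"
  define z where "z = y ^ n' - x ^ m'"
  have d: "n = d * n'" "m = d * m'" "d > 0"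
    using assms(3) by (auto simp: d_def n'_def m'_def)
  have cop: "coprime m' n'"
    unfolding m'_def n'_def d_def using assms(3) by (intro div_gcd_coprime) auto
  have n': "n' \<ge> 2"
  proof (rule ccontr)
    assume "\<not> n' \<ge> 2"
    with d assms(3) have "n' = 1" by (cases n') auto
    with d assms(5) show False by simp
  qed

  have x: "x \<noteq> 0" "subdegree x = n"
    by (simp_all add: x_def)
  have "fps_nth (y - fps_X ^ m) m = 0"
    using sub assms(6) by (intro nth_less_subdegree_zero) simp
  hence y0: "y \<noteq> 0"
    by auto
  have ylow: "fps_nth y i = fps_nth (fps_X ^ m :: 'k fps) i" if "i \<le> m" for i
    using nth_less_subdegree_zero[of i "y - fps_X ^ m"] that sub(2) assms(6) by simp
  have ysub: "subdegree y = m"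
    using ylow by (intro subdegreeI) auto

  have xm: "x ^ m' = fps_X ^ (m * n')"
    by (simp add: x_def d power_mult[symmetric] mult_ac)
  have z: "z \<noteq> 0" "subdegree z = lam + (n' - 1) * m"
    unfolding z_def xm using subdegree_power_diff[of y m n'] sub assms(6) n' by auto
  have gap: "(n' - 1) * m > n"
  proof -
    have "1 * m \<le> (n' - 1) * m"
      using n' by (intro mult_right_mono) auto
    with assms(4) show ?thesis by linarith
  qed

  \<comment> \<open>The series of order above \<open>N\<close>: what cannot influence whether the order of
    \<open>G(x, y)\<close> is \<open>N\<close>.\<close>
  define J where "J = range (\<lambda>q::'k fps. fps_X ^ Suc N * q)"
  have J_I: "g \<in> J" if "g \<noteq> 0" "subdegree g > N" for g
  proof -
    have "g = fps_X ^ Suc N * fps_shift (Suc N) g"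
      using that(2) by (metis Suc_leI fps_shift_times_fps_X_power mult.commute)
    thus ?thesis unfolding J_def by blast
  qed
  have xz: "x * z \<in> J"
    using x z gap by (intro J_I) (simp_all add: N_def)
  have yz: "y * z \<in> J"
    using y0 ysub z gap assms(4) by (intro J_I) (simp_all add: N_def)

  define E where "E = insert z {x ^ i * y ^ j | i j. j < n'}"
  have mono: "x ^ i * y ^ j \<in> fps_vs.span (E \<union> J)" for i j
    unfolding E_def J_def using n' xz yz
    by (intro monomial_in_span[where q = m'] z_def) (auto simp: J_def)
  have msub: "x ^ i * y ^ j \<noteq> 0" "subdegree (x ^ i * y ^ j) = n * i + m * j" for i j
    using x y0 ysub by (simp_all add: subdegree_power mult.commute)

  assume N: "subdegree (subst1 G (fps_X ^ n) y) = lam + 2 * n"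
  define g where "g = subst1 G x y"
  have gN: "subdegree g = N"
    using N by (simp add: g_def N_def x_def)
  have "fps_nth x 0 = 0" "fps_nth y 0 = 0"
    using ylow[of 0] assms(3,4) by (auto simp: x_def)
  then obtain q where q: "g =
      (\<Sum>i\<le>N. \<Sum>j\<le>N. fps_const (bcoeff G i j) * (x ^ i * y ^ j)) + fps_X ^ Suc N * q"
    unfolding g_def using subst1_truncate by blast
  have "g \<in> fps_vs.span (E \<union> J)"
    unfolding q
    by (intro fps_vs.span_add fps_vs.span_sum fps_vs.span_scale mono fps_vs.span_base)
       (auto simp: J_def)
  moreover have "fps_vs.span J = J"
  proof (rule fps_vs.span_eq_iff[THEN iffD2], rule fps_vs.subspaceI)
    show "0 \<in> J"
      unfolding J_def by (rule range_eqI[of _ _ 0]) simp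
  next
    fix a b assume "a \<in> J" "b \<in> J"
    then obtain a' b' where "a = fps_X ^ Suc N * a'" "b = fps_X ^ Suc N * b'"
      by (auto simp: J_def)
    hence "a + b = fps_X ^ Suc N * (a' + b')"
      by (simp add: algebra_simps)
    thus "a + b \<in> J" unfolding J_def by blast
  next
    fix c a assume "a \<in> J"
    then obtain a' where "a = fps_X ^ Suc N * a'"
      by (auto simp: J_def)
    hence "fps_const c * a = fps_X ^ Suc N * (fps_const c * a')"
      by (simp add: algebra_simps)
    thus "fps_const c * a \<in> J" unfolding J_def by blast
  qed
  ultimately obtain e s where e: "e \<in> fps_vs.span E" and "s \<in> J" "g = e + s"
    unfolding fps_vs.span_Un by auto
  then obtain r where g: "g = e + fps_X ^ Suc N * r"
    unfolding J_def by blast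
  have "g \<noteq> 0"
    using gN assms(6) by (auto simp: N_def)
  have eg: "fps_nth e i = fps_nth g i" if "i \<le> N" for i
    using that by (simp add: g fps_X_power_mult_nth del: power_Suc)
  have eN: "fps_nth e N \<noteq> 0"
    using eg[of N] \<open>g \<noteq> 0\<close> gN by auto
  moreover have "subdegree e = N"
    using eN eg gN by (intro subdegreeI) auto
  moreover have "inj_on subdegree E"
  proof -
    have ndvd: "\<not> d dvd subdegree z"
      unfolding z(2) using assms(7) d_def by (simp add: dvd_add_left_iff)
    have dvd: "d dvd subdegree (x ^ i * y ^ j)" for i j
      unfolding msub by (simp add: d_def)
    have "a = b" if ab: "a \<in> E - {z}" "b \<in> E - {z}" "subdegree a = subdegree b" for a b
    proof -
      obtain i j i' j' where "a = x ^ i * y ^ j" "j < n'" "b = x ^ i' * y ^ j'" "j' < n'"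
        using ab(1,2) unfolding E_def by blast
      moreover from this have "i = i' \<and> j = j'"
        using ab(3) unfolding n'_def d_def
        by (intro exponents_inj[OF assms(3), of _ m]) (simp_all only: msub)
      ultimately show ?thesis by simp
    qed
    moreover have "subdegree a \<noteq> subdegree z" if a: "a \<in> E - {z}" for a
    proof -
      obtain i j where "a = x ^ i * y ^ j"
        using a unfolding E_def by blast
      thus ?thesis using dvd[of i j] ndvd by metis
    qed
    ultimately show ?thesis
      unfolding inj_on_def by (metis DiffI singletonD)
  qed
  moreover have "0 \<notin> E"
    using z(1) msub(1) by (auto simp: E_def)
  ultimately have "N \<in> subdegree ` E"
    using subdegree_span[OF e] by force
  then consider "N = subdegree z" | i j where "N = n * i + m * j"
    unfolding E_def by (auto simp: msub)
  thus False
  proof cases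
    case 1
    hence "d * (2 * n') = d * ((n' - 1) * m')"
      using d(1,2) by (simp add: z(2) N_def algebra_simps)
    hence "n' dvd (n' - 1) * m'"
      using d(3) by (metis dvd_triv_right mult_cancel_left less_numeral_extra(3))
    hence "n' dvd n' - 1"
      using cop by (simp add: coprime_commute coprime_dvd_mult_left_iff)
    thus False
      using n' by (auto dest: dvd_imp_le)
  next
    case 2
    have "d dvd lam + 2 * n"
      using 2 unfolding N_def by (simp add: d_def)
    hence "d dvd lam"
      by (simp add: d_def dvd_add_left_iff)
    thus False
      using assms(7) by (simp add: d_def)
  qed
qed

theorem corollary4p2:
  fixes f :: "'k::{alg_closed_field, field_char_0} fps fps"
    and \<iota> :: "'k fps fps set \<Rightarrow> 'k fps"
    and y h :: "'k fps" and b :: 'k and n m lam :: nat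
  assumes "Factorial_Ring.irreducible f"
    and "ord2 f = n" and "n \<ge> 2"
    and "\<not> quasi_homogeneous f"
    and "parametric_representation f \<iota> (fps_X ^ n) y"
    and "y = fps_X ^ m + fps_const b * fps_X ^ lam + h" and "\<forall>i\<le>lam. fps_nth h i = 0"
    and "m > n" and "\<not> n dvd m" and "b \<noteq> 0" and "lam > m"
    and "lam + n \<notin> value_semigroup f \<iota>"
    and "\<not> gcd m n dvd lam"
  shows "lam + 2 * n \<notin> value_semigroup f \<iota>"
proof
  assume "lam + 2 * n \<in> value_semigroup f \<iota>"
  then obtain r where r: "r \<in> carrier (branch_ring f)" "subdegree (\<iota> r) = lam + 2 * n"
    unfolding value_semigroup_def by force
  have "\<iota> r \<in> range (\<lambda>G. subst1 G (fps_X ^ n) y)"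
    using assms(5) r(1) unfolding parametric_representation_def by blast
  then obtain G where G: "\<iota> r = subst1 G (fps_X ^ n) y"
    by blast
  have diff: "y - fps_X ^ m = fps_const b * fps_X ^ lam + h"
    using assms(6) by simp
  have lead: "fps_nth (y - fps_X ^ m) lam = b"
    unfolding diff using assms(7) by simp
  have "subdegree (y - fps_X ^ m) = lam"
    using lead assms(7,10) unfolding diff by (intro subdegreeI) auto
  moreover have "y - fps_X ^ m \<noteq> 0"
    using lead assms(10) by auto
  ultimately have "subdegree (subst1 G (fps_X ^ n) y) \<noteq> lam + 2 * n"
    using assms by (intro subdegree_subst1_neq[where m = m]) auto
  with G r(2) show False by simp
qed

end
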